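(* Let $G$ be a locally compact abelian group, $H\subseteq G$ a compact open subgroup, and let $A,B\in\operatorname{Aut}(G)$ be expansive with respect to $H$ and such that $A^*$ and $B^*$ are expansive with respect to $H^\perp$ as well. Then, for every sequence $\Lambda\subseteq G$, $$D^+_A(\Lambda)=D^+_B(\Lambda)\qquad\text{and}\qquad D^-_A(\Lambda)=D^-_B(\Lambda).$$
   Context: Locally compact abelian (LCA) groups are Hausdorff and written additively; $\widehat{G}$ is the Pontryagin dual, $\langle x,\xi\rangle$ denotes the character $\xi$ evaluated at $x$, and $H^\perp=\{\xi\in\widehat{G}:\langle h,\xi\rangle=1\ \forall h\in H\}$ (a compact open subgroup of $\widehat{G}$). The Haar measure is normalized by $m_G(H)=1$. $\operatorname{Aut}(G)$ is the group of homeomorphic automorphisms of $G$; the modulus $|A|>0$ of $A\in\operatorname{Aut}(G)$ is defined by $m_G(AU)=|A|\,m_G(U)$ for Borel $U$; the adjoint $A^*\in\operatorname{Aut}(\widehat{G})$ is given by $\langle Ax,\gamma\rangle=\langle x,A^*\gamma\rangle$. $A$ is expansive with respect to a compact open subgroup $H$ if $H\subsetneq AH$ and $\bigcap_{n\le0}A^nH=\{0\}$ (and likewise for automorphisms of $\widehat{G}$ and $H^\perp$). For an automorphism $A$ expansive with respect to $H$, $n\in\mathbb{Z}$ and $x\in G$, put $Q_n(x)=Q_n^A(x)=x+A^nH$. The upper and lower Beurling densities of $\Lambda\subseteq G$ are $$D^+_A(\Lambda)=\limsup_{n\to+\infty}\frac{1}{|A|^n}\max_{x\in G}\#\{\Lambda\cap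 Q_n^A(x)\},\qquad D^-_A(\Lambda)=\liminf_{n\to+\infty}\frac{1}{|A|^n}\min_{x\in G}\#\{\Lambda\cap Q_n^A(x)\},$$ with values in $[0,+\infty]$. *)

theory Defs
  imports "HOL-Analysis.Analysis"
begin

typedef (overloaded) 'a character =
  "{\<xi>. continuous_on UNIV \<xi> \<and> (\<forall>x y. \<xi> (x + y) = \<xi> x * \<xi> y) \<and> (\<forall>x. norm (\<xi> x) = 1)}
     :: ('a::topological_ab_group_add \<Rightarrow> complex) set"
  morphisms char_fun Abs_character
  by (rule exI[of _ "\<lambda>_. 1"]) auto

definition pairing :: "'a::topological_ab_group_add \<Rightarrow> 'a character \<Rightarrow> complex"
  where "pairing x \<xi> = char_fun \<xi> x"

lemma continuous_pairing: "continuous_on S (\<lambda>x. pairing x \<xi>)"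
  using char_fun[of \<xi>] unfolding pairing_def by (auto intro: continuous_on_subset)

lemma pairing_add_left: "pairing (x + y) \<xi> = pairing x \<xi> * pairing y \<xi>"
  and norm_pairing [simp]: "norm (pairing x \<xi>) = 1"
  using char_fun[of \<xi>] unfolding pairing_def by auto

lemma character_eqI: "(\<And>x. pairing x \<xi> = pairing x \<psi>) \<Longrightarrow> \<xi> = \<psi>"
  unfolding pairing_def by (metis char_fun_inject ext)

lemma pairing_Abs:
  assumes "continuous_on UNIV f" "\<And>x y. f (x + y) = f x * f y" "\<And>x. norm (f x) = 1"
  shows "pairing x (Abs_character f) = f x"
  using assms unfolding pairing_def by (subst Abs_character_inverse) auto

text \<open>The dual is written additively, with the pointwise operations on characters.\<close>

instantiation character :: (topological_ab_group_add) ab_group_add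
begin

definition zero_character :: "'a character"
  where "zero_character = Abs_character (\<lambda>_. 1)"
definition plus_character :: "'a character \<Rightarrow> 'a character \<Rightarrow> 'a character"
  where "plus_character \<xi> \<psi> = Abs_character (\<lambda>x. pairing x \<xi> * pairing x \<psi>)"
definition uminus_character :: "'a character \<Rightarrow> 'a character"
  where "uminus_character \<xi> = Abs_character (\<lambda>x. cnj (pairing x \<xi>))"
definition minus_character :: "'a character \<Rightarrow> 'a character \<Rightarrow> 'a character"
  where "minus_character \<xi> \<psi> = \<xi> + - \<psi>"

lemma pairing_0: "pairing x (0 :: 'a character) = 1"
  unfolding zero_character_def by (subst pairing_Abs) auto

lemma pairing_plus: "pairing x (\<xi> + \<psi> :: 'a character) = pairing x \<xi> * pairing x \<psi>"
  unfolding plus_character_def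
  by (subst pairing_Abs)
    (auto intro!: continuous_intros continuous_pairing simp: pairing_add_left norm_mult)

lemma pairing_uminus: "pairing x (- \<xi> :: 'a character) = cnj (pairing x \<xi>)"
  unfolding uminus_character_def
  by (subst pairing_Abs)
    (auto intro!: continuous_intros continuous_pairing simp: pairing_add_left)

instance
proof
  fix a b c :: "'a character"
  show "a + b + c = a + (b + c)" "a + b = b + a" "0 + a = a"
    by (auto intro!: character_eqI simp: pairing_plus pairing_0)
  have "cnj (pairing x a) * pairing x a = 1" for x
    by (metis complex_norm_square mult.commute norm_pairing of_real_1 power_one)
  then show "- a + a = 0"
    by (intro character_eqI) (simp add: pairing_plus pairing_0 pairing_uminus)
  show "a - b = a + - b" by (simp add: minus_character_def)
qed

end

text \<open>The topology of the dual is that of uniform convergence on compact sets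
  (the compact-open topology).\<close>

definition char_nbhd :: "'a::topological_ab_group_add character \<Rightarrow> 'a set \<Rightarrow> real \<Rightarrow> 'a character set"
  where "char_nbhd \<xi> K e = {\<psi>. \<forall>x\<in>K. dist (pairing x \<psi>) (pairing x \<xi>) < e}"

instantiation character :: (topological_ab_group_add) topological_space
begin

definition open_character :: "'a character set \<Rightarrow> bool"
  where "open_character S \<longleftrightarrow>
    (\<forall>\<xi>\<in>S. \<exists>K e. compact K \<and> e > 0 \<and> char_nbhd \<xi> K e \<subseteq> S)"

instance
proof
  show "open (UNIV :: 'a character set)"
    unfolding open_character_def by (auto intro!: exI[of _ "{}"] exI[of _ "1::real"])
next
  fix S T :: "'a character set"
  assume ST: "open S" "open T"
  show "open (S \<inter> T)"
    unfolding open_character_def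
  proof
    fix \<xi> assume "\<xi> \<in> S \<inter> T"
    with ST obtain K e L d where *: "compact K" "e > 0" "char_nbhd \<xi> K e \<subseteq> S"
        "compact L" "d > 0" "char_nbhd \<xi> L d \<subseteq> T"
      unfolding open_character_def by (metis IntD1 IntD2)
    then have "compact (K \<union> L) \<and> min e d > 0 \<and> char_nbhd \<xi> (K \<union> L) (min e d) \<subseteq> S \<inter> T"
      by (auto simp: char_nbhd_def)
    then show "\<exists>K e. compact K \<and> e > 0 \<and> char_nbhd \<xi> K e \<subseteq> S \<inter> T" by blast
  qed
next
  fix \<S> :: "'a character set set"
  assume "\<forall>S\<in>\<S>. open S"
  then show "open (\<Union>\<S>)"
    unfolding open_character_def by (meson Union_iff Union_upper subset_trans)
qed

end

lemma open_char_nbhd: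
  assumes "compact K"
  shows "open (char_nbhd \<xi> K e)"
  unfolding open_character_def
proof
  fix \<psi> assume \<psi>: "\<psi> \<in> char_nbhd \<xi> K e"
  show "\<exists>L d. compact L \<and> d > 0 \<and> char_nbhd \<psi> L d \<subseteq> char_nbhd \<xi> K e"
  proof (cases "K = {}")
    case True
    then show ?thesis
      by (auto simp: char_nbhd_def intro!: exI[of _ "{}"] exI[of _ "1::real"])
  next
    case False
    have "continuous_on K (\<lambda>x. dist (pairing x \<psi>) (pairing x \<xi>))"
      by (intro continuous_intros continuous_pairing)
    from continuous_attains_sup[OF assms False this] obtain z where z: "z \<in> K"
      "\<And>x. x \<in> K \<Longrightarrow> dist (pairing x \<psi>) (pairing x \<xi>) \<le> dist (pairing z \<psi>) (pairing z \<xi>)"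
      by blast
    define d where "d = e - dist (pairing z \<psi>) (pairing z \<xi>)"
    have "d > 0" using \<psi> z(1) by (auto simp: d_def char_nbhd_def)
    moreover have "char_nbhd \<psi> K d \<subseteq> char_nbhd \<xi> K e"
    proof
      fix \<phi> assume \<phi>: "\<phi> \<in> char_nbhd \<psi> K d"
      have "dist (pairing x \<phi>) (pairing x \<xi>) < e" if "x \<in> K" for x
        using \<phi> z(2)[OF that] that dist_triangle[of "pairing x \<phi>" "pairing x \<xi>" "pairing x \<psi>"]
        unfolding char_nbhd_def d_def by fastforce
      then show "\<phi> \<in> char_nbhd \<xi> K e" by (simp add: char_nbhd_def)
    qed
    ultimately show ?thesis using assms by blast
  qed
qed

lemma self_in_char_nbhd: "e > 0 \<Longrightarrow> \<xi> \<in> char_nbhd \<xi> K e"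
  by (simp add: char_nbhd_def)

lemma eventually_char_nbhd:
  "compact K \<Longrightarrow> e > 0 \<Longrightarrow> eventually (\<lambda>\<psi>. \<psi> \<in> char_nbhd \<xi> K e) (nhds \<xi>)"
  by (intro eventually_nhds_in_open open_char_nbhd self_in_char_nbhd)

lemma tendsto_characterI:
  fixes f :: "'b \<Rightarrow> 'a::topological_ab_group_add character"
  assumes "\<And>K e. compact K \<Longrightarrow> e > 0 \<Longrightarrow> eventually (\<lambda>x. f x \<in> char_nbhd \<xi> K e) F"
  shows "(f \<longlongrightarrow> \<xi>) F"
proof (rule topological_tendstoI)
  fix S assume "open S" "\<xi> \<in> S"
  then obtain K e where "compact K" "e > 0" "char_nbhd \<xi> K e \<subseteq> S"
    unfolding open_character_def by blast
  with assms[of K e] show "eventually (\<lambda>x. f x \<in> S) F"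
    by (auto elim!: eventually_mono)
qed

instance character :: (topological_ab_group_add) t2_space
proof
  fix \<xi> \<psi> :: "'a character"
  assume "\<xi> \<noteq> \<psi>"
  then obtain x where x: "pairing x \<xi> \<noteq> pairing x \<psi>" using character_eqI by blast
  define e where "e = dist (pairing x \<xi>) (pairing x \<psi>) / 2"
  have e: "e > 0" using x by (simp add: e_def)
  have "char_nbhd \<xi> {x} e \<inter> char_nbhd \<psi> {x} e = {}"
  proof (rule ccontr)
    assume "char_nbhd \<xi> {x} e \<inter> char_nbhd \<psi> {x} e \<noteq> {}"
    then obtain \<phi> where "dist (pairing x \<phi>) (pairing x \<xi>) < e" "dist (pairing x \<phi>) (pairing x \<psi>) < e"
      by (auto simp: char_nbhd_def)
    then show False
      using dist_triangle3[of "pairing x \<xi>" "pairing x \<psi>" "pairing x \<phi>"] unfolding e_def by linarith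
  qed
  then show "\<exists>U V. open U \<and> open V \<and> \<xi> \<in> U \<and> \<psi> \<in> V \<and> U \<inter> V = {}"
    using open_char_nbhd[of "{x}"] self_in_char_nbhd[OF e] by (metis compact_sing)
qed

instance character :: (topological_ab_group_add) topological_ab_group_add
proof
  fix a b :: "'a character"
  show "LIM x (nhds a \<times>\<^sub>F nhds b). fst x + snd x :> nhds (a + b)"
  proof (rule tendsto_characterI)
    fix K :: "'a set" and e :: real
    assume K: "compact K" "e > 0"
    have "eventually (\<lambda>x. fst x \<in> char_nbhd a K (e/2) \<and> snd x \<in> char_nbhd b K (e/2))
            (nhds a \<times>\<^sub>F nhds b)"
      using eventually_char_nbhd[of K "e/2" a] eventually_char_nbhd[of K "e/2" b] K
      by (auto simp: eventually_prod_filter)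
    then show "eventually (\<lambda>x. fst x + snd x \<in> char_nbhd (a + b) K e) (nhds a \<times>\<^sub>F nhds b)"
    proof (rule eventually_mono)
      fix x assume x: "fst x \<in> char_nbhd a K (e/2) \<and> snd x \<in> char_nbhd b K (e/2)"
      have "dist (pairing y (fst x + snd x)) (pairing y (a + b)) < e" if "y \<in> K" for y
      proof -
        have 1: "dist (pairing y (fst x)) (pairing y a) < e/2"
             "dist (pairing y (snd x)) (pairing y b) < e/2"
          using x that by (auto simp: char_nbhd_def)
        have "norm (pairing y (fst x) * pairing y (snd x) - pairing y a * pairing y b)
           \<le> norm (pairing y (fst x) - pairing y a) + norm (pairing y (snd x) - pairing y b)"
        proof -
          have "pairing y (fst x) * pairing y (snd x) - pairing y a * pairing y b
            = (pairing y (fst x) - pairing y a) * pairing y (snd x)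
              + pairing y a * (pairing y (snd x) - pairing y b)"
            by (simp add: algebra_simps)
          also have "norm \<dots> \<le> norm ((pairing y (fst x) - pairing y a) * pairing y (snd x))
              + norm (pairing y a * (pairing y (snd x) - pairing y b))"
            by (rule norm_triangle_ineq)
          finally show ?thesis by (simp add: norm_mult)
        qed
        with 1 show ?thesis by (simp add: pairing_plus dist_norm)
      qed
      then show "fst x + snd x \<in> char_nbhd (a + b) K e" by (simp add: char_nbhd_def)
    qed
  qed
next
  fix a :: "'a character"
  show "(uminus \<longlongrightarrow> - a) (nhds a)"
  proof (rule tendsto_characterI)
    fix K :: "'a set" and e :: real
    assume K: "compact K" "e > 0"
    have "dist (cnj z) (cnj w) = dist z w" for z w
      by (metis complex_cnj_diff complex_mod_cnj dist_norm)
    then show "eventually (\<lambda>x. - x \<in> char_nbhd (- a) K e) (nhds a)"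
      using eventually_char_nbhd[OF K, of a] by (simp add: char_nbhd_def pairing_uminus)
  qed
qed

definition annihilator :: "'a::topological_ab_group_add set \<Rightarrow> 'a character set"
  where "annihilator H = {\<xi>. \<forall>h\<in>H. pairing h \<xi> = 1}"

definition compact_open_subgroup :: "'a::topological_ab_group_add set \<Rightarrow> bool"
  where "compact_open_subgroup H \<longleftrightarrow>
    compact H \<and> open H \<and> 0 \<in> H \<and> (\<forall>x\<in>H. \<forall>y\<in>H. x + y \<in> H) \<and> (\<forall>x\<in>H. - x \<in> H)"

definition Aut :: "('a::topological_ab_group_add \<Rightarrow> 'a) set"
  where "Aut = {A. homeomorphism UNIV UNIV A (inv A) \<and> (\<forall>x y. A (x + y) = A x + A y)}"

definition dual_aut ::
    "('a::topological_ab_group_add \<Rightarrow> 'a) \<Rightarrow> 'a character \<Rightarrow> 'a character"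
  where "dual_aut A \<gamma> = (THE \<gamma>'. \<forall>x. pairing (A x) \<gamma> = pairing x \<gamma>')"

lemma pairing_dual_aut:
  assumes "A \<in> Aut"
  shows "pairing x (dual_aut A \<gamma>) = pairing (A x) \<gamma>"
proof -
  have A: "continuous_on UNIV A" "\<And>x y. A (x + y) = A x + A y"
    using assms by (auto simp: Aut_def homeomorphism_def)
  let ?g = "Abs_character (\<lambda>x. pairing (A x) \<gamma>)"
  have "pairing x ?g = pairing (A x) \<gamma>" for x
    by (subst pairing_Abs)
      (auto simp: A(2) pairing_add_left
        intro: continuous_on_compose2[OF continuous_pairing A(1), of UNIV])
  then have "dual_aut A \<gamma> = ?g"
    unfolding dual_aut_def by (intro the_equality) (auto intro: character_eqI)
  with \<open>\<And>x. pairing x ?g = pairing (A x) \<gamma>\<close> show ?thesis by simp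
qed

lemma inv_Aut:
  assumes "A \<in> Aut"
  shows "inv A \<in> Aut" "A (inv A x) = x" "inv A (A x) = x"
proof -
  have h: "homeomorphism UNIV UNIV A (inv A)" and a: "\<And>x y. A (x + y) = A x + A y"
    using assms by (auto simp: Aut_def)
  show 1: "A (inv A x) = x" "inv A (A x) = x" for x using h by (auto simp: homeomorphism_def)
  then have "inv (inv A) = A" by (metis bijI' inv_inv_eq)
  moreover have "inv A (x + y) = inv A x + inv A y" for x y by (metis a 1)
  ultimately show "inv A \<in> Aut" using homeomorphism_symD[OF h] by (simp add: Aut_def)
qed

lemma dual_aut_in_Aut:
  assumes "A \<in> Aut"
  shows "dual_aut A \<in> Aut"
proof -
  have cont: "continuous_on UNIV (dual_aut B)" if B: "B \<in> Aut" for B :: "'a \<Rightarrow> 'a"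
    unfolding continuous_on_def
  proof (intro ballI tendsto_characterI)
    fix \<xi> :: "'a character" and K :: "'a set" and e :: real
    assume K: "compact K" "e > 0"
    have "compact (B ` K)"
      using K B by (intro compact_continuous_image)
        (auto simp: Aut_def homeomorphism_def intro: continuous_on_subset)
    then have "eventually (\<lambda>\<psi>. \<psi> \<in> char_nbhd \<xi> (B ` K) e) (nhds \<xi>)"
      using K by (intro eventually_char_nbhd)
    then show "eventually (\<lambda>\<psi>. dual_aut B \<psi> \<in> char_nbhd (dual_aut B \<xi>) K e) (at \<xi>)"
      by (auto simp: char_nbhd_def pairing_dual_aut[OF B] eventually_nhds_conv_at)
  qed
  note I = inv_Aut[OF assms]
  have l: "dual_aut (inv A) (dual_aut A \<gamma>) = \<gamma>" for \<gamma>
    by (rule character_eqI) (simp add: pairing_dual_aut assms I)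
  have r: "dual_aut A (dual_aut (inv A) \<gamma>) = \<gamma>" for \<gamma>
    by (rule character_eqI) (simp add: pairing_dual_aut assms I)
  have inv: "inv (dual_aut A) = dual_aut (inv A)"
    using l r by (intro inv_equality) auto
  have "homeomorphism UNIV UNIV (dual_aut A) (dual_aut (inv A))"
    using l r by (intro homeomorphismI cont assms I) auto
  moreover have "dual_aut A (\<gamma> + \<delta>) = dual_aut A \<gamma> + dual_aut A \<delta>" for \<gamma> \<delta>
    by (rule character_eqI) (simp add: pairing_dual_aut assms pairing_plus)
  ultimately show ?thesis by (simp add: Aut_def inv)
qed

definition aut_pow :: "('a \<Rightarrow> 'a) \<Rightarrow> int \<Rightarrow> 'a \<Rightarrow> 'a"
  where "aut_pow A n = (if n \<ge> 0 then A ^^ nat n else inv A ^^ nat (- n))"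

definition expansive :: "('a::topological_ab_group_add \<Rightarrow> 'a) \<Rightarrow> 'a set \<Rightarrow> bool"
  where "expansive A H \<longleftrightarrow> H \<subset> A ` H \<and> (\<Inter>n\<in>{..0}. aut_pow A n ` H) = {0}"

text \<open>A Haar measure is a nonzero translation-invariant Radon measure on the Borel sets.\<close>

definition haar_measure :: "'a::topological_ab_group_add measure \<Rightarrow> bool"
  where "haar_measure m \<longleftrightarrow>
    sets m = sets borel \<and>
    emeasure m UNIV \<noteq> 0 \<and>
    (\<forall>x. \<forall>U\<in>sets borel. emeasure m ((+) x ` U) = emeasure m U) \<and>
    (\<forall>K. compact K \<longrightarrow> emeasure m K < \<infinity>) \<and>
    (\<forall>U\<in>sets borel. emeasure m U = (INF V\<in>{V. open V \<and> U \<subseteq> V}. emeasure m V)) \<and>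
    (\<forall>V. open V \<longrightarrow> emeasure m V = (SUP K\<in>{K. compact K \<and> K \<subseteq> V}. emeasure m K))"

definition modulus :: "'a::topological_ab_group_add measure \<Rightarrow> ('a \<Rightarrow> 'a) \<Rightarrow> real"
  where "modulus m A =
    (THE c. c > 0 \<and> (\<forall>U\<in>sets borel. emeasure m (A ` U) = ennreal c * emeasure m U))"

definition Q :: "('a::topological_ab_group_add \<Rightarrow> 'a) \<Rightarrow> 'a set \<Rightarrow> int \<Rightarrow> 'a \<Rightarrow> 'a set"
  where "Q A H n x = (+) x ` (aut_pow A n ` H)"

text \<open>The points are given as a family \<open>(\<lambda>\<^sub>i)\<^bsub>i \<in> I\<^esub>\<close>, counted with multiplicity, so that both
  sequences with repetitions and subsets of the group (\<open>I = \<Lambda>\<close> and \<open>\<lambda> = id\<close>) are covered.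
  The value of the counting measure is \<open>\<infinity>\<close> on infinite sets.\<close>

definition num_points :: "'i set \<Rightarrow> ('i \<Rightarrow> 'a) \<Rightarrow> 'a set \<Rightarrow> ennreal"
  where "num_points I lam S = emeasure (count_space UNIV) {i\<in>I. lam i \<in> S}"

text \<open>The maximum over all \<open>x\<close> is a supremum in \<open>[0,\<infinity>]\<close>, since finite counts may be unbounded.\<close>

definition upper_density ::
  "'a::topological_ab_group_add measure \<Rightarrow> 'a set \<Rightarrow> ('a \<Rightarrow> 'a) \<Rightarrow> 'i set \<Rightarrow> ('i \<Rightarrow> 'a) \<Rightarrow> ennreal"
  where "upper_density m H A I lam =
    Limsup at_top (\<lambda>n::int. ennreal (1 / modulus m A powi n) * (SUP x. num_points I lam (Q A H n x)))"

definition lower_density ::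
  "'a::topological_ab_group_add measure \<Rightarrow> 'a set \<Rightarrow> ('a \<Rightarrow> 'a) \<Rightarrow> 'i set \<Rightarrow> ('i \<Rightarrow> 'a) \<Rightarrow> ennreal"
  where "lower_density m H A I lam =
    Liminf at_top (\<lambda>n::int. ennreal (1 / modulus m A powi n) * (INF x. num_points I lam (Q A H n x)))"

end

theory Submission
  imports Defs
begin

text \<open>
  Write \<open>f\<^sub>A(n)\<close> for \<open>|A|\<^sup>-\<^sup>n\<close> times the supremum over \<open>x\<close> of the number of points in \<open>x + A\<^sup>n H\<close>. The
  main observation is that \<open>f\<^sub>A(n) \<le> f\<^sub>B(k)\<close> as soon as \<open>B\<^sup>k H \<subseteq> A\<^sup>n H\<close>. In that case \<open>A\<^sup>n H\<close> is a
  disjoint union of \<open>N\<close> cosets of \<open>B\<^sup>k H\<close>, comparing Haar measures gives \<open>N = |A|\<^sup>n / |B|\<^sup>k\<close>, and a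
  translate of \<open>A\<^sup>n H\<close> therefore contains at most \<open>N\<close> times as many points as the fullest translate
  of \<open>B\<^sup>k H\<close>; with infima in place of suprema the inequality is reversed
  (\<open>density_comparison\<close>).

  For fixed \<open>k\<close> the inclusion holds for all large \<open>n\<close>. Indeed, expansiveness of the adjoint says that
  no nontrivial character is trivial on the open subgroup \<open>K = \<Union>\<^sub>n A\<^sup>n H\<close>. Characters separate points
  from open subgroups, so \<open>K\<close> is the whole group (\<open>union_of_iterates_eq_UNIV\<close>), and the compact
  set \<open>B\<^sup>k H\<close> is contained in one member of the increasing open cover \<open>A\<^sup>n H\<close>. Hence
  \<open>limsup f\<^sub>A \<le> f\<^sub>B(k)\<close> for every \<open>k\<close>, so \<open>limsup f\<^sub>A \<le> liminf f\<^sub>B \<le> limsup f\<^sub>B\<close>. Exchanging \<open>A\<close> and \<open>B\<close> yields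
  equality, and the lower densities are treated in the same way.

  Two ingredients need an argument of their own. The separating character is obtained
  by extending a homomorphism into the circle from a subgroup to the whole group with Zorn's
  lemma, using that the circle is divisible (\<open>separating_hom\<close>). The modulus is a definite
  description, so it has to be shown that \<open>U \<mapsto> m(AU)\<close> is a multiple of \<open>m\<close>: the cosets of the subgroups \<open>A\<^sup>-\<^sup>n H\<close> form a countable
  basis that is closed under intersection up to the empty set, and on a coset the claim is a
  statement about indices (\<open>modulus_exists\<close>).
\<close>

section \<open>Subgroups and cosets\<close>

definition add_subgroup :: "'a::ab_group_add set \<Rightarrow> bool"
  where "add_subgroup S \<longleftrightarrow> 0 \<in> S \<and> (\<forall>x\<in>S. \<forall>y\<in>S. x + y \<in> S) \<and> (\<forall>x\<in>S. - x \<in> S)"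

lemma add_subgroupD:
  assumes "add_subgroup S"
  shows "0 \<in> S" "x \<in> S \<Longrightarrow> y \<in> S \<Longrightarrow> x + y \<in> S" "x \<in> S \<Longrightarrow> - x \<in> S"
    "x \<in> S \<Longrightarrow> y \<in> S \<Longrightarrow> x - y \<in> S"
  using assms unfolding add_subgroup_def by (auto simp: diff_conv_add_uminus simp del: add_uminus_conv_diff)

lemma mem_coset_iff: "y \<in> (+) x ` K \<longleftrightarrow> y - x \<in> (K :: 'a::ab_group_add set)"
  by (auto simp: image_iff algebra_simps intro: bexI[of _ "y - x"])

lemma coset_eq:
  assumes "add_subgroup K" "y \<in> (+) x ` K"
  shows "(+) x ` K = (+) y ` K"
proof -
  have "z - x \<in> K \<longleftrightarrow> z - y \<in> K" for z
    using add_subgroupD(2)[OF assms(1), of "z - y" "y - x"]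
      add_subgroupD(4)[OF assms(1), of "z - x" "y - x"] assms(2)
    by (auto simp: mem_coset_iff)
  then show ?thesis by (intro set_eqI) (simp only: mem_coset_iff)
qed

section \<open>Characters separating a point from a subgroup\<close>

fun nat_mult :: "nat \<Rightarrow> 'a::ab_group_add \<Rightarrow> 'a"
  where "nat_mult 0 y = 0" | "nat_mult (Suc n) y = y + nat_mult n y"

lemma nat_mult_add: "nat_mult (m + n) y = nat_mult m y + nat_mult n y"
  by (induction m) (auto simp: algebra_simps)

lemma nat_mult_mult: "nat_mult (m * n) y = nat_mult m (nat_mult n y)"
  by (induction m) (auto simp: nat_mult_add)

text \<open>The graph of a homomorphism from a subgroup into the circle. Working with graphs makes
  extension into inclusion, so that the union of a chain is an upper bound for it.\<close>

definition partial_character :: "('a::ab_group_add \<times> complex) set \<Rightarrow> bool"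
  where "partial_character F \<longleftrightarrow>
    (0, 1) \<in> F \<and>
    (\<forall>x v y w. (x, v) \<in> F \<longrightarrow> (y, w) \<in> F \<longrightarrow> (x + y, v * w) \<in> F) \<and>
    (\<forall>x v. (x, v) \<in> F \<longrightarrow> (- x, cnj v) \<in> F) \<and>
    (\<forall>x v. (x, v) \<in> F \<longrightarrow> norm v = 1) \<and>
    (\<forall>v. (0, v) \<in> F \<longrightarrow> v = 1)"

lemma partial_characterD:
  assumes "partial_character F"
  shows "(0, 1) \<in> F" "(x, v) \<in> F \<Longrightarrow> (y, w) \<in> F \<Longrightarrow> (x + y, v * w) \<in> F"
    "(x, v) \<in> F \<Longrightarrow> (- x, cnj v) \<in> F" "(x, v) \<in> F \<Longrightarrow> norm v = 1" "(0, v) \<in> F \<Longrightarrow> v = 1"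
  using assms unfolding partial_character_def by blast+

lemma norm_one_cnj_mult:
  assumes "norm (z::complex) = 1"
  shows "z * cnj z = 1" "cnj z * z = 1"
  using assms by (metis complex_norm_square mult.commute of_real_1 power_one)+

lemma partial_character_unique:
  assumes F: "partial_character F" and "(x, v) \<in> F" "(x, w) \<in> F"
  shows "v = w"
proof -
  have "(x + - x, v * cnj w) \<in> F" using assms partial_characterD[OF F] by blast
  then have "v * cnj w = 1" using partial_characterD[OF F] by simp
  then have "v * (cnj w * w) = w" by (simp add: mult.assoc[symmetric])
  then show ?thesis using norm_one_cnj_mult partial_characterD(4)[OF F assms(3)] by simp
qed

lemma partial_character_nat_mult:
  assumes "partial_character F" "(x, v) \<in> F"
  shows "(nat_mult n x, v ^ n) \<in> F"
  by (induction n) (auto intro: partial_characterD assms)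

text \<open>The circle is divisible: if \<open>n\<close> is the least positive integer such that \<open>n y\<close> lies in the domain
  of the partial character, any \<open>n\<close>-th root of its value at \<open>n y\<close> is an admissible value at \<open>y\<close>. Since \<open>y\<close> is
  outside the domain, \<open>n \<ge> 2\<close>, and there are enough roots to avoid \<open>1\<close>; this is what makes the
  extension nontrivial at \<open>y\<close>.\<close>

lemma compatible_value:
  fixes F :: "('a::ab_group_add \<times> complex) set"
  assumes F: "partial_character F" and y: "y \<notin> fst ` F"
  obtains \<zeta> where "norm \<zeta> = 1" "\<zeta> \<noteq> 1" "\<And>k w. (nat_mult k y, w) \<in> F \<Longrightarrow> w = \<zeta> ^ k"
proof (cases "\<exists>n>0. nat_mult n y \<in> fst ` F")
  case False
  \<comment> \<open>With no positive multiple of \<open>y\<close> in the domain every value at \<open>y\<close> is admissible.\<close>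
  have "w = (-1) ^ k" if "(nat_mult k y, w) \<in> F" for k w
  proof (cases k)
    case 0
    then show ?thesis using that partial_characterD(5)[OF F] by simp
  next
    case (Suc j)
    moreover have "nat_mult k y \<in> fst ` F" using that by (rule image_eqI[rotated]) simp
    ultimately have False using \<open>\<not> (\<exists>n>0. nat_mult n y \<in> fst ` F)\<close> by (metis zero_less_Suc)
    then show ?thesis ..
  qed
  then show ?thesis using that[of "-1"] by simp
next
  case True
  define n where "n = (LEAST n. n > 0 \<and> nat_mult n y \<in> fst ` F)"
  have n: "n > 0" "nat_mult n y \<in> fst ` F"
    using LeastI_ex[OF True] unfolding n_def by blast+
  have least: "n \<le> k" if "k > 0" "nat_mult k y \<in> fst ` F" for k
    unfolding n_def using that by (intro Least_le) simp
  have "n \<noteq> 1" using n(2) y by (metis One_nat_def add.right_neutral nat_mult.simps)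
  with n(1) have n2: "n \<ge> 2" by simp
  obtain v where v: "(nat_mult n y, v) \<in> F" using n(2) by auto
  have nv: "norm v = 1" using partial_characterD(4)[OF F v] .
  have card: "card {z. z ^ n = v} = n"
    using card_nth_roots[of v n] nv n(1) by force
  have "\<not> {z. z ^ n = v} \<subseteq> {1}"
    using card_mono[of "{1::complex}" "{z. z ^ n = v}"] card n2 by auto
  then obtain \<zeta> where z: "\<zeta> ^ n = v" "\<zeta> \<noteq> 1" by blast
  have "norm \<zeta> ^ n = 1" using z(1) nv by (metis norm_power)
  then have nz: "norm \<zeta> = 1"
    using n(1) by (metis norm_ge_zero power_eq_1_iff not_gr0 real_norm_def abs_of_nonneg)
  have "w = \<zeta> ^ k" if k: "(nat_mult k y, w) \<in> F" for k w
  proof -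
    \<comment> \<open>Division with remainder and minimality of \<open>n\<close> show that \<open>n\<close> divides \<open>k\<close>.\<close>
    have 1: "(nat_mult (n * (k div n)) y, v ^ (k div n)) \<in> F"
      using partial_character_nat_mult[OF F v, of "k div n"]
      by (simp only: nat_mult_mult[symmetric] mult.commute)
    have "nat_mult k y = nat_mult (n * (k div n)) y + nat_mult (k mod n) y"
      by (subst nat_mult_add[symmetric]) simp
    then have "nat_mult (k mod n) y = nat_mult k y + - nat_mult (n * (k div n)) y" by simp
    then have "(nat_mult (k mod n) y, w * cnj (v ^ (k div n))) \<in> F"
      using partial_characterD(2)[OF F k partial_characterD(3)[OF F 1]] by simp
    then have "nat_mult (k mod n) y \<in> fst ` F" by force
    then have "k mod n = 0"
      using least[of "k mod n"] n(1) mod_less_divisor[of n k] by (meson not_gr0 not_less)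
    then have k': "n * (k div n) = k" by auto
    have "w = v ^ (k div n)" using partial_character_unique[OF F k] 1 k' by simp
    also have "\<dots> = \<zeta> ^ (n * (k div n))" by (simp add: z(1)[symmetric] power_mult)
    finally show ?thesis using k' by simp
  qed
  then show ?thesis using that nz z(2) by blast
qed

text \<open>The extension sends \<open>d + a y - b y\<close> to the value at \<open>d\<close> times \<open>\<zeta>\<^sup>a\<close> over \<open>\<zeta>\<^sup>b\<close>. Pairs of natural
  exponents \<open>a\<close>, \<open>b\<close> stand for the integer \<open>a - b\<close>, and \<open>cnj \<zeta>\<close> is the inverse of \<open>\<zeta>\<close>.\<close>

lemma partial_character_extend:
  fixes F :: "('a::ab_group_add \<times> complex) set"
  assumes F: "partial_character F" and y: "y \<notin> fst ` F"
  obtains F' \<zeta> where "partial_character F'" "F \<subseteq> F'" "(y, \<zeta>) \<in> F'" "\<zeta> \<noteq> 1"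
proof -
  obtain \<zeta> where z: "norm \<zeta> = 1" "\<zeta> \<noteq> 1" "\<And>k w. (nat_mult k y, w) \<in> F \<Longrightarrow> w = \<zeta> ^ k"
    using compatible_value[OF assms] by blast
  define F' where "F' = {(d + nat_mult a y - nat_mult b y, w * \<zeta> ^ a * cnj \<zeta> ^ b) | d w a b. (d, w) \<in> F}"
  have F'I: "(u, v) \<in> F'" if "(d, w) \<in> F" "u = d + nat_mult a y - nat_mult b y"
    "v = w * \<zeta> ^ a * cnj \<zeta> ^ b" for u v d w a b
    using that unfolding F'_def by blast
  have sub: "F \<subseteq> F'"
    using F'I[of _ _ _ 0 0] by auto
  have yz: "(y, \<zeta>) \<in> F'"
    by (rule F'I[OF partial_characterD(1)[OF F], of _ "Suc 0" 0]) auto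
  have cancel: "\<zeta> ^ i * cnj \<zeta> ^ i = 1" for i
    by (metis norm_one_cnj_mult(1)[OF z(1)] power_mult_distrib power_one)
  have "partial_character F'"
    unfolding partial_character_def
  proof (intro conjI allI impI)
    show "(0, 1) \<in> F'" using sub partial_characterD(1)[OF F] by blast
  next
    fix u v u' v' assume "(u, v) \<in> F'" "(u', v') \<in> F'"
    then obtain d w a b d' w' a' b' where *: "(d, w) \<in> F" "u = d + nat_mult a y - nat_mult b y"
      "v = w * \<zeta> ^ a * cnj \<zeta> ^ b" "(d', w') \<in> F" "u' = d' + nat_mult a' y - nat_mult b' y"
      "v' = w' * \<zeta> ^ a' * cnj \<zeta> ^ b'"
      unfolding F'_def by blast
    show "(u + u', v * v') \<in> F'"
      by (rule F'I[OF partial_characterD(2)[OF F *(1,4)], of _ "a + a'" "b + b'"])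
        (auto simp: * nat_mult_add power_add algebra_simps)
  next
    fix u v assume "(u, v) \<in> F'"
    then obtain d w a b where *: "(d, w) \<in> F" "u = d + nat_mult a y - nat_mult b y"
      "v = w * \<zeta> ^ a * cnj \<zeta> ^ b"
      unfolding F'_def by blast
    show "(- u, cnj v) \<in> F'"
      by (rule F'I[OF partial_characterD(3)[OF F *(1)], of _ b a]) (auto simp: * algebra_simps)
    show "norm v = 1"
      by (simp add: * norm_mult norm_power z partial_characterD(4)[OF F *(1)])
  next
    fix v assume "(0, v) \<in> F'"
    then obtain d w a b where *: "(d, w) \<in> F" "0 = d + nat_mult a y - nat_mult b y"
      "v = w * \<zeta> ^ a * cnj \<zeta> ^ b"
      unfolding F'_def by blast
    note w1 = norm_one_cnj_mult[OF partial_characterD(4)[OF F *(1)]]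
    show "v = 1"
    proof (cases "a \<ge> b")
      case True
      then obtain k where k: "a = b + k" using le_Suc_ex by blast
      have "nat_mult k y = - d" using *(2) by (simp add: k nat_mult_add algebra_simps eq_neg_iff_add_eq_0)
      then have "cnj w = \<zeta> ^ k" using z(3) partial_characterD(3)[OF F *(1)] by simp
      then have "w * \<zeta> ^ k = 1" using w1 by simp
      moreover have "v = (w * \<zeta> ^ k) * (\<zeta> ^ b * cnj \<zeta> ^ b)"
        by (simp add: *(3) k power_add)
      ultimately show ?thesis by (simp add: cancel)
    next
      case False
      then obtain k where k: "b = a + k" using le_Suc_ex by (meson linear)
      have "nat_mult k y = d" using *(2) by (simp add: k nat_mult_add algebra_simps)
      then have "w = \<zeta> ^ k" using z(3) *(1) by simp
      then have "v = (\<zeta> ^ k * cnj \<zeta> ^ k) * (\<zeta> ^ a * cnj \<zeta> ^ a)"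
        by (simp add: *(3) k power_add)
      then show ?thesis by (simp add: cancel)
    qed
  qed
  then show ?thesis using that sub yz z(2) by blast
qed

lemma partial_character_Union:
  assumes ne: "\<C> \<noteq> {}" and chain: "subset.chain (Collect partial_character) \<C>"
  shows "partial_character (\<Union>\<C>)"
proof -
  have pc: "partial_character F" if "F \<in> \<C>" for F
    using chain that by (auto simp: subset.chain_def)
  have join: "\<exists>F\<in>\<C>. p \<in> F \<and> q \<in> F" if "p \<in> \<Union>\<C>" "q \<in> \<Union>\<C>" for p q
  proof -
    obtain X Y where XY: "X \<in> \<C>" "p \<in> X" "Y \<in> \<C>" "q \<in> Y" using \<open>p \<in> \<Union>\<C>\<close> \<open>q \<in> \<Union>\<C>\<close> by blast
    then have "X \<subseteq> Y \<or> Y \<subseteq> X" using chain by (simp add: subset_chain_def)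
    then show ?thesis using XY by (meson subsetD)
  qed
  show ?thesis
    unfolding partial_character_def
  proof (intro conjI allI impI)
    obtain F where F: "F \<in> \<C>" using ne by blast
    show "(0, 1) \<in> \<Union>\<C>" using partial_characterD(1)[OF pc[OF F]] F by blast
  next
    fix x v y w assume "(x, v) \<in> \<Union>\<C>" "(y, w) \<in> \<Union>\<C>"
    then obtain F where F: "F \<in> \<C>" "(x, v) \<in> F" "(y, w) \<in> F" using join[of "(x, v)" "(y, w)"] by metis
    show "(x + y, v * w) \<in> \<Union>\<C>"
      using partial_characterD(2)[OF pc[OF F(1)] F(2,3)] F(1) by blast
  next
    fix x v assume "(x, v) \<in> \<Union>\<C>"
    then obtain F where F: "F \<in> \<C>" "(x, v) \<in> F" by blast
    show "(- x, cnj v) \<in> \<Union>\<C>" using partial_characterD(3)[OF pc[OF F(1)] F(2)] F(1) by blast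
    show "norm v = 1" by (rule partial_characterD(4)[OF pc[OF F(1)] F(2)])
  next
    fix v assume "(0, v) \<in> \<Union>\<C>"
    then obtain F where F: "F \<in> \<C>" "(0, v) \<in> F" by blast
    show "v = 1" by (rule partial_characterD(5)[OF pc[OF F(1)] F(2)])
  qed
qed

text \<open>One extension step makes the trivial homomorphism on \<open>K\<close> nontrivial at \<open>x\<close>; a maximal extension
  of the result, given by Zorn's lemma, is defined everywhere, since otherwise it could be extended
  by another step.\<close>

lemma separating_hom:
  fixes K :: "'a::ab_group_add set"
  assumes K: "add_subgroup K" and x: "x \<notin> K"
  obtains \<phi> :: "'a \<Rightarrow> complex" where "\<And>y z. \<phi> (y + z) = \<phi> y * \<phi> z" "\<And>y. norm (\<phi> y) = 1"
    "\<And>k. k \<in> K \<Longrightarrow> \<phi> k = 1" "\<phi> x \<noteq> 1"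
proof -
  have "partial_character (K \<times> {1})"
    using add_subgroupD[OF K] by (auto simp: partial_character_def)
  then obtain F0 \<zeta> where F0: "partial_character F0" "K \<times> {1} \<subseteq> F0" "(x, \<zeta>) \<in> F0" "\<zeta> \<noteq> 1"
    using partial_character_extend[of "K \<times> {1}" x] x by auto
  define P where "P = {F. partial_character F \<and> F0 \<subseteq> F}"
  have "\<exists>M\<in>P. \<forall>X\<in>P. M \<subseteq> X \<longrightarrow> X = M"
  proof (rule subset_Zorn_nonempty)
    show "P \<noteq> {}" using F0(1) by (auto simp: P_def)
  next
    fix \<C> assume C: "\<C> \<noteq> {}" "subset.chain P \<C>"
    then have "partial_character (\<Union>\<C>)"
      by (intro partial_character_Union) (auto simp: subset_chain_def P_def)
    moreover have "F0 \<subseteq> \<Union>\<C>"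
    proof -
      obtain X where "X \<in> \<C>" using C(1) by blast
      moreover from this have "F0 \<subseteq> X" using C(2) by (auto simp: subset_chain_def P_def)
      ultimately show ?thesis by blast
    qed
    ultimately show "\<Union>\<C> \<in> P" by (simp add: P_def)
  qed
  then obtain F where "F \<in> P" and max_P: "\<And>X. X \<in> P \<Longrightarrow> F \<subseteq> X \<Longrightarrow> X = F" by meson
  then have F: "partial_character F" "F0 \<subseteq> F" by (auto simp: P_def)
  have max: "X = F" if "partial_character X" "F \<subseteq> X" for X
    using that F(2) by (intro max_P) (auto simp: P_def)
  have total: "\<exists>v. (y, v) \<in> F" for y
  proof (rule ccontr)
    assume "\<nexists>v. (y, v) \<in> F"
    then have y: "y \<notin> fst ` F" by auto
    obtain F' \<eta> where "partial_character F'" "F \<subseteq> F'" "(y, \<eta>) \<in> F'"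
      using partial_character_extend[OF F(1) y] by metis
    with max[of F'] y show False by force
  qed
  define \<phi> where "\<phi> y = (SOME v. (y, v) \<in> F)" for y
  have chi: "(y, \<phi> y) \<in> F" for y unfolding \<phi>_def using total by (rule someI_ex)
  have eq: "\<phi> y = v" if "(y, v) \<in> F" for y v
    using partial_character_unique[OF F(1) chi that] .
  show ?thesis
  proof (rule that[of \<phi>])
    show "\<phi> (y + z) = \<phi> y * \<phi> z" for y z
      by (intro eq partial_characterD(2)[OF F(1)] chi)
    show "norm (\<phi> y) = 1" for y using partial_characterD(4)[OF F(1) chi] .
    show "\<phi> k = 1" if "k \<in> K" for k using F0(2) F(2) that by (intro eq) blast
    show "\<phi> x \<noteq> 1" using eq[of x \<zeta>] F0(3,4) F(2) by blast
  qed
qed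

text \<open>The algebraic homomorphism from the previous lemma is constant on the cosets of the open
  subgroup \<open>K\<close>, hence continuous, and so a genuine character in the annihilator.\<close>

lemma annihilator_trivial_imp_UNIV:
  fixes K :: "'a::topological_ab_group_add set"
  assumes K: "add_subgroup K" and "open K" and triv: "annihilator K = {0}"
  shows "K = UNIV"
proof (rule ccontr)
  assume "K \<noteq> UNIV"
  then obtain x where x: "x \<notin> K" by blast
  obtain \<phi> :: "'a \<Rightarrow> complex" where chi: "\<And>y z. \<phi> (y + z) = \<phi> y * \<phi> z" "\<And>y. norm (\<phi> y) = 1"
    "\<And>k. k \<in> K \<Longrightarrow> \<phi> k = 1" "\<phi> x \<noteq> 1"
    using separating_hom[OF K x] by blast
  have cont: "continuous_on UNIV \<phi>"
    unfolding continuous_on_def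
  proof
    fix y
    have "open ((\<lambda>z. z - y) -` K)"
      by (intro open_vimage \<open>open K\<close> continuous_intros)
    then have "eventually (\<lambda>z. z \<in> (\<lambda>z. z - y) -` K) (at y)"
      using add_subgroupD(1)[OF K] by (intro eventually_at_topological[THEN iffD2]) auto
    then have "eventually (\<lambda>z. \<phi> z = \<phi> y) (at y)"
    proof eventually_elim
      case (elim z)
      then have "\<phi> (z - y) = 1" using chi(3) by simp
      then show ?case using chi(1)[of "z - y" y] by simp
    qed
    then show "(\<phi> \<longlongrightarrow> \<phi> y) (at y)" by (rule tendsto_eventually)
  qed
  have p: "pairing y (Abs_character \<phi>) = \<phi> y" for y
    using pairing_Abs[OF cont] chi by blast
  have "Abs_character \<phi> \<in> annihilator K" by (simp add: annihilator_def p chi(3))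
  then have "Abs_character \<phi> = 0" using triv by simp
  then show False using p[of x] chi(4) by (simp add: pairing_0)
qed

section \<open>Automorphisms and their iterates\<close>

lemma AutD:
  assumes "A \<in> Aut"
  shows "A (x + y) = A x + A y" "A (- x) = - A x" "A 0 = 0"
    "inj A" "bij A" "continuous_on S A"
proof -
  show add: "A (x + y) = A x + A y" for x y using assms by (simp add: Aut_def)
  show zero: "A 0 = 0" using add[of 0 0] by simp
  show "A (- x) = - A x" for x
    using add[of x "- x"] zero by (simp add: eq_neg_iff_add_eq_0 add.commute)
  show "bij A" using inv_Aut[OF assms] by (metis bijI')
  then show "inj A" by (rule bij_is_inj)
  show "continuous_on S A"
    using assms by (auto simp: Aut_def homeomorphism_def intro: continuous_on_subset)
qed

lemma Aut_image_eq_vimage: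
  assumes "A \<in> Aut"
  shows "A ` S = inv A -` S"
proof
  show "A ` S \<subseteq> inv A -` S" by (auto simp: inv_Aut(3)[OF assms])
  show "inv A -` S \<subseteq> A ` S"
  proof
    fix x assume "x \<in> inv A -` S"
    then have "A (inv A x) \<in> A ` S" by simp
    then show "x \<in> A ` S" by (simp only: inv_Aut(2)[OF assms])
  qed
qed

lemma open_Aut_image:
  assumes "A \<in> Aut" "open S"
  shows "open (A ` S)"
  unfolding Aut_image_eq_vimage[OF assms(1)]
  by (rule open_vimage[OF assms(2) AutD(6)[OF inv_Aut(1)[OF assms(1)]]])

lemma funpow_Aut:
  assumes "A \<in> Aut"
  shows "A ^^ n \<in> Aut"
proof (induction n)
  case 0
  then show ?case by (simp add: Aut_def homeomorphism_def id_def[symmetric])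
next
  case (Suc n)
  have "inv (A \<circ> A ^^ n) = inv (A ^^ n) \<circ> inv A"
    by (intro o_inv_distrib AutD(5) assms Suc)
  moreover have "homeomorphism UNIV UNIV (A \<circ> A ^^ n) (inv (A ^^ n) \<circ> inv A)"
    by (rule homeomorphism_compose) (use Suc assms in \<open>auto simp: Aut_def\<close>)
  ultimately show ?case using AutD(1)[OF assms] AutD(1)[OF Suc] by (simp add: Aut_def del: o_apply) simp
qed

lemma compact_open_subgroupD:
  assumes "compact_open_subgroup H"
  shows "compact H" "open H" "add_subgroup H"
  using assms by (auto simp: compact_open_subgroup_def add_subgroup_def)

lemma compact_open_subgroup_image:
  assumes "A \<in> Aut" "compact_open_subgroup H"
  shows "compact_open_subgroup (A ` H)"
proof -
  have "compact (A ` H)" "open (A ` H)"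
    using assms compact_open_subgroupD AutD(6)[OF assms(1)]
    by (auto intro!: compact_continuous_image open_Aut_image)
  moreover have "0 \<in> A ` H"
    using AutD(3)[OF assms(1)] add_subgroupD(1)[OF compact_open_subgroupD(3)[OF assms(2)]] by force
  moreover have "A x + A y \<in> A ` H" "- A x \<in> A ` H" if "x \<in> H" "y \<in> H" for x y
    using that add_subgroupD(2,3)[OF compact_open_subgroupD(3)[OF assms(2)]]
    by (simp_all flip: AutD(1,2)[OF assms(1)])
  ultimately show ?thesis by (auto simp: compact_open_subgroup_def)
qed

text \<open>The adjoint turns images of \<open>H\<close> into annihilators: \<open>\<xi>\<close> annihilates \<open>A\<^sup>n H\<close> exactly when
  \<open>(A\<^sup>*)\<^sup>n \<xi>\<close> annihilates \<open>H\<close>, that is, when \<open>\<xi> \<in> (A\<^sup>*)\<^sup>-\<^sup>n H\<^sup>\<bottom>\<close>. So the annihilator of the union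
  of the \<open>A\<^sup>n H\<close> is the intersection that expansiveness of the adjoint makes trivial.\<close>

lemma union_of_iterates_eq_UNIV:
  assumes A: "A \<in> Aut" and H: "compact_open_subgroup H" and mono: "mono (\<lambda>n. (A ^^ n) ` H)"
    and dual: "expansive (dual_aut A) (annihilator H)"
  shows "(\<Union>n. (A ^^ n) ` H) = UNIV"
proof (rule annihilator_trivial_imp_UNIV)
  have sub: "compact_open_subgroup ((A ^^ n) ` H)" for n
    by (intro compact_open_subgroup_image funpow_Aut A H)
  show "open (\<Union>n. (A ^^ n) ` H)"
    using compact_open_subgroupD(2)[OF sub] by blast
  have D: "dual_aut A \<in> Aut" by (rule dual_aut_in_Aut[OF A])
  show "add_subgroup (\<Union>n. (A ^^ n) ` H)"
    unfolding add_subgroup_def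
  proof (intro conjI ballI)
    show "0 \<in> (\<Union>n. (A ^^ n) ` H)"
      using add_subgroupD(1)[OF compact_open_subgroupD(3)[OF sub]] by blast
    fix x assume "x \<in> (\<Union>n. (A ^^ n) ` H)"
    then obtain i where i: "x \<in> (A ^^ i) ` H" by blast
    then show "- x \<in> (\<Union>n. (A ^^ n) ` H)"
      using add_subgroupD(3)[OF compact_open_subgroupD(3)[OF sub[of i]], of x] by blast
    fix y assume "y \<in> (\<Union>n. (A ^^ n) ` H)"
    then obtain j where j: "y \<in> (A ^^ j) ` H" by blast
    have "x \<in> (A ^^ max i j) ` H" "y \<in> (A ^^ max i j) ` H"
      using i j monoD[OF mono, of i "max i j"] monoD[OF mono, of j "max i j"] by auto
    then show "x + y \<in> (\<Union>n. (A ^^ n) ` H)"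
      using add_subgroupD(2)[OF compact_open_subgroupD(3)[OF sub[of "max i j"]], of x y] by blast
  qed
  have pair: "pairing x ((dual_aut A ^^ n) \<xi>) = pairing ((A ^^ n) x) \<xi>" for x n \<xi>
    by (induction n arbitrary: x) (auto simp: pairing_dual_aut[OF A] funpow_swap1[of A])
  have "\<xi> = 0" if \<xi>: "\<xi> \<in> annihilator (\<Union>n. (A ^^ n) ` H)" for \<xi>
  proof -
    have "\<xi> \<in> aut_pow (dual_aut A) n ` annihilator H" if "n \<le> 0" for n
    proof
      show "(dual_aut A ^^ nat (- n)) \<xi> \<in> annihilator H"
        using \<xi> by (auto simp: annihilator_def pair)
      have "(inv (dual_aut A) ^^ k) ((dual_aut A ^^ k) \<xi>) = \<xi>" for k
        by (induction k) (auto simp: funpow_swap1[of "inv (dual_aut A)"] inv_Aut(3)[OF D])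
      then show "\<xi> = aut_pow (dual_aut A) n ((dual_aut A ^^ nat (- n)) \<xi>)"
        using that by (cases "n = 0") (auto simp: aut_pow_def)
    qed
    then show ?thesis using dual by (auto simp: expansive_def)
  qed
  then show "annihilator (\<Union>n. (A ^^ n) ` H) = {0}"
    by (auto simp: annihilator_def pairing_0)
qed

lemma funpow_image_mono:
  assumes "H \<subseteq> A ` H"
  shows "mono (\<lambda>n. (A ^^ n) ` H)"
proof (rule incseq_SucI)
  fix n
  have "(A ^^ Suc n) ` H = (A ^^ n) ` (A ` H)" by (simp add: funpow_Suc_right image_comp del: funpow.simps)
  then show "(A ^^ n) ` H \<subseteq> (A ^^ Suc n) ` H" using assms by (simp only: image_mono)
qed

lemma funpow_image_antimono:
  assumes "A ` H \<subseteq> H"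
  shows "antimono (\<lambda>n. (A ^^ n) ` H)"
proof (rule decseq_SucI)
  fix n
  have "(A ^^ Suc n) ` H = (A ^^ n) ` (A ` H)" by (simp add: funpow_Suc_right image_comp del: funpow.simps)
  then show "(A ^^ Suc n) ` H \<subseteq> (A ^^ n) ` H" using assms by (simp only: image_mono)
qed

lemma compact_subset_increasing_union:
  fixes U :: "nat \<Rightarrow> 'a::topological_space set"
  assumes "compact K" "\<And>n. open (U n)" "mono U" "K \<subseteq> (\<Union>n. U n)"
  obtains n where "K \<subseteq> U n"
proof -
  obtain C where C: "finite C" "K \<subseteq> (\<Union>c\<in>C. U c)"
    using compactE_image[of K UNIV U] assms by auto
  have "U c \<subseteq> U (Max (insert 0 C))" if "c \<in> C" for c
    using C(1) that by (intro monoD[OF \<open>mono U\<close>]) auto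
  with C(2) that show ?thesis by blast
qed

section \<open>Decomposition into cosets\<close>

definition transversal :: "'a::ab_group_add set \<Rightarrow> 'a set \<Rightarrow> 'a set \<Rightarrow> bool"
  where "transversal T K L \<longleftrightarrow>
    finite T \<and> (\<Union>t\<in>T. (+) t ` K) = L \<and> disjoint_family_on (\<lambda>t. (+) t ` K) T"

lemma open_coset:
  fixes K :: "'a::topological_ab_group_add set"
  assumes "open K"
  shows "open ((+) x ` K)"
proof -
  have "(+) x ` K = (\<lambda>z. z - x) -` K" by (auto simp: mem_coset_iff)
  moreover have "open \<dots>" by (intro open_vimage assms continuous_intros)
  ultimately show ?thesis by simp
qed

text \<open>Finitely many cosets cover \<open>L\<close> by compactness. Passing from each covering coset to a chosen
  representative identifies equal cosets, and distinct ones are disjoint.\<close>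

lemma transversal_exists:
  fixes K :: "'a::topological_ab_group_add set"
  assumes K: "add_subgroup K" "open K" and L: "add_subgroup L" "compact L" and "K \<subseteq> L"
  obtains T where "transversal T K L"
proof -
  have self: "x \<in> (+) x ` K" for x using add_subgroupD(1)[OF K(1)] by (simp add: mem_coset_iff)
  obtain C where C: "C \<subseteq> L" "finite C" "L \<subseteq> (\<Union>c\<in>C. (+) c ` K)"
  proof (rule compactE_image[OF L(2), of L "\<lambda>c. (+) c ` K"])
    show "L \<subseteq> (\<Union>c\<in>L. (+) c ` K)" using self by (intro subsetI UN_I)
  qed (rule open_coset[OF K(2)])
  define rep where "rep x = (SOME y. y \<in> (+) x ` K)" for x
  have rep: "rep x \<in> (+) x ` K" for x unfolding rep_def using self by (rule someI)
  have eq: "(+) (rep x) ` K = (+) x ` K" for x using coset_eq[OF K(1) rep] by simp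
  have "transversal (rep ` C) K L"
    unfolding transversal_def
  proof (intro conjI)
    show "finite (rep ` C)" using C(2) by simp
    have "(+) c ` K \<subseteq> L" if "c \<in> C" for c
      using that C(1) \<open>K \<subseteq> L\<close> add_subgroupD(2)[OF L(1)] by blast
    then show "(\<Union>t\<in>rep ` C. (+) t ` K) = L" using C(3) by (auto simp: eq)
    have "rep x = rep y" if "z \<in> (+) x ` K" "z \<in> (+) y ` K" for x y z
      using coset_eq[OF K(1)] that unfolding rep_def by metis
    then show "disjoint_family_on (\<lambda>t. (+) t ` K) (rep ` C)"
      by (auto simp: disjoint_family_on_def eq)
  qed
  then show ?thesis using that by blast
qed

lemma image_coset:
  assumes "A \<in> Aut"
  shows "A ` (+) x ` K = (+) (A x) ` A ` K"
  by (simp add: image_image AutD(1)[OF assms])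

lemma transversal_image:
  assumes A: "A \<in> Aut" and T: "transversal T K L"
  shows "transversal (A ` T) (A ` K) (A ` L)" "card (A ` T) = card T"
proof -
  have inj: "inj A" by (rule AutD(4)[OF A])
  show "card (A ` T) = card T" by (rule card_image[OF inj_on_subset[OF inj subset_UNIV]])
  have "disjoint_family_on (\<lambda>t. (+) t ` A ` K) (A ` T)"
    unfolding disjoint_family_on_def
  proof (intro ballI impI)
    fix s t assume "s \<in> A ` T" "t \<in> A ` T" "s \<noteq> t"
    then obtain s' t' where "s = A s'" "t = A t'" "s' \<in> T" "t' \<in> T" "s' \<noteq> t'" by blast
    with T show "(+) s ` A ` K \<inter> (+) t ` A ` K = {}"
      by (simp add: transversal_def disjoint_family_on_def image_coset[OF A, symmetric]
          image_Int[OF inj, symmetric])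
  qed
  moreover have "(\<Union>t\<in>A ` T. (+) t ` A ` K) = A ` L"
    using T by (auto simp: transversal_def image_coset[OF A, symmetric])
  ultimately show "transversal (A ` T) (A ` K) (A ` L)"
    using T by (simp add: transversal_def)
qed

lemma emeasure_transversal:
  assumes m: "haar_measure m" and T: "transversal T K L" and K: "open K"
  shows "emeasure m L = of_nat (card T) * emeasure m K"
proof -
  have sets: "sets m = sets borel" using m by (simp add: haar_measure_def)
  have "emeasure m L = emeasure m (\<Union>t\<in>T. (+) t ` K)" using T by (simp add: transversal_def)
  also have "\<dots> = (\<Sum>t\<in>T. emeasure m ((+) t ` K))"
    using T open_coset[OF K] by (intro sum_emeasure[symmetric]) (auto simp: transversal_def sets)
  also have "\<dots> = (\<Sum>t\<in>T. emeasure m K)"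
    using m K by (intro sum.cong) (auto simp: haar_measure_def)
  finally show ?thesis by simp
qed

lemma num_points_transversal:
  assumes T: "transversal T K L"
  shows "num_points I lam ((+) x ` L) = (\<Sum>t\<in>T. num_points I lam ((+) (x + t) ` K))"
proof -
  have eq: "(+) x ` L = (\<Union>t\<in>T. (+) (x + t) ` K)"
    using T by (force simp: transversal_def image_iff add.assoc)
  have "{i\<in>I. lam i \<in> (+) x ` L} = (\<Union>t\<in>T. {i\<in>I. lam i \<in> (+) (x + t) ` K})"
    by (auto simp: eq)
  moreover have "disjoint_family_on (\<lambda>t. {i\<in>I. lam i \<in> (+) (x + t) ` K}) T"
    using T by (force simp: transversal_def disjoint_family_on_def mem_coset_iff diff_diff_add[symmetric])
  ultimately show ?thesis
    unfolding num_points_def using T by (simp add: sum_emeasure transversal_def)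
qed

section \<open>The modulus of an expansive automorphism\<close>

text \<open>The complements of the iterates are an increasing open cover of the compact set \<open>H - V\<close>.\<close>

lemma iterates_neighbourhood_base:
  fixes H :: "'a::{topological_ab_group_add, t2_space} set"
  assumes A: "A \<in> Aut" and H: "compact_open_subgroup H" and anti: "antimono (\<lambda>n. (A ^^ n) ` H)"
    and inter: "(\<Inter>n. (A ^^ n) ` H) = {0}" and V: "open V" "0 \<in> V"
  obtains n where "(A ^^ n) ` H \<subseteq> V"
proof -
  have "closed ((A ^^ n) ` H)" for n
    by (intro compact_imp_closed compact_open_subgroupD(1) compact_open_subgroup_image funpow_Aut A H)
  then have op: "open (- (A ^^ n) ` H)" for n by blast
  have "compact (H - V)" by (intro compact_diff compact_open_subgroupD(1) H V)
  moreover have "mono (\<lambda>n. - (A ^^ n) ` H)"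
    using anti unfolding monotone_on_def by blast
  moreover have "H - V \<subseteq> (\<Union>n. - (A ^^ n) ` H)" using inter V(2) by auto
  ultimately obtain n where n: "H - V \<subseteq> - (A ^^ n) ` H"
    using compact_subset_increasing_union[of "H - V" "\<lambda>n. - (A ^^ n) ` H"] op by metis
  have "(A ^^ n) ` H \<subseteq> H" using antimonoD[OF anti, of 0 n] by simp
  then show ?thesis using that[of n] n by blast
qed

lemma funpow_inv_commute:
  assumes "A \<in> Aut"
  shows "(inv A ^^ n) (A x) = A ((inv A ^^ n) x)"
  by (induction n arbitrary: x) (auto simp: inv_Aut(2,3)[OF assms])

locale expanding_automorphism =
  fixes H :: "'a::{topological_ab_group_add, t2_space} set" and m :: "'a measure" and A :: "'a \<Rightarrow> 'a"
  assumes H: "compact_open_subgroup H"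
    and m: "haar_measure m" and mH: "emeasure m H = 1"
    and A: "A \<in> Aut" and exp: "expansive A H"
    and dual_exp: "expansive (dual_aut A) (annihilator H)"
begin

lemma subset_image: "H \<subseteq> A ` H"
  using exp by (auto simp: expansive_def)

lemma mono_iterates: "mono (\<lambda>n. (A ^^ n) ` H)"
  by (rule funpow_image_mono[OF subset_image])

lemma iterate_subgroup: "compact_open_subgroup ((A ^^ n) ` H)"
  and inv_iterate_subgroup: "compact_open_subgroup ((inv A ^^ n) ` H)"
  by (intro compact_open_subgroup_image funpow_Aut A inv_Aut H)+

lemma Union_iterates: "(\<Union>n. (A ^^ n) ` H) = UNIV"
  by (rule union_of_iterates_eq_UNIV[OF A H mono_iterates dual_exp])

lemma antimono_inv_iterates: "antimono (\<lambda>n. (inv A ^^ n) ` H)"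
  by (rule funpow_image_antimono) (use subset_image inv_Aut(3)[OF A] in force)

lemma Inter_inv_iterates: "(\<Inter>n. (inv A ^^ n) ` H) = {0}"
proof -
  have "aut_pow A (- int n) = inv A ^^ n" for n by (cases "n = 0") (simp_all add: aut_pow_def)
  moreover have "{..0::int} = range (\<lambda>n. - int n)"
    by (auto simp: image_iff) (metis nonpos_int_cases)
  ultimately show ?thesis using exp by (auto simp: expansive_def)
qed

text \<open>The empty set is included to make the family closed under intersection.\<close>

definition small_cosets :: "'a set set"
  where "small_cosets = insert {} (range (\<lambda>(x, n). (+) x ` (inv A ^^ n) ` H))"

text \<open>For fixed \<open>n\<close> the group is the union of the countably many \<open>A\<^sup>k H\<close>, each of which consists of
  finitely many cosets of \<open>A\<^sup>-\<^sup>n H\<close>.\<close>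

lemma countable_small_cosets: "countable small_cosets"
proof -
  have "\<exists>T. transversal T ((inv A ^^ n) ` H) ((A ^^ k) ` H)" for n k
  proof -
    have "(inv A ^^ n) ` H \<subseteq> (A ^^ k) ` H"
      using antimonoD[OF antimono_inv_iterates, of 0 n] monoD[OF mono_iterates, of 0 k] by auto
    then show ?thesis
      using transversal_exists compact_open_subgroupD inv_iterate_subgroup iterate_subgroup by metis
  qed
  then obtain T where T: "\<And>n k. transversal (T n k) ((inv A ^^ n) ` H) ((A ^^ k) ` H)" by metis
  have "small_cosets \<subseteq> insert {} (\<Union>n k. (\<lambda>t. (+) t ` (inv A ^^ n) ` H) ` T n k)"
  proof
    fix S assume "S \<in> small_cosets"
    then consider "S = {}" | x n where "S = (+) x ` (inv A ^^ n) ` H"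
      unfolding small_cosets_def by auto
    then show "S \<in> insert {} (\<Union>n k. (\<lambda>t. (+) t ` (inv A ^^ n) ` H) ` T n k)"
    proof cases
      case 2
      obtain k where "x \<in> (A ^^ k) ` H" using Union_iterates by blast
      then obtain t where t: "t \<in> T n k" "x \<in> (+) t ` (inv A ^^ n) ` H"
        using T[of n k] unfolding transversal_def by blast
      have "S = (+) t ` (inv A ^^ n) ` H"
        using coset_eq[OF compact_open_subgroupD(3)[OF inv_iterate_subgroup] t(2)] 2 by simp
      with t(1) show ?thesis by blast
    qed simp
  qed
  moreover have "countable \<dots>"
    using T by (intro countable_insert countable_UN countable_image countable_finite countableI_type)
      (simp add: transversal_def)
  ultimately show ?thesis by (rule countable_subset)
qed

lemma topological_basis_small_cosets: "topological_basis small_cosets"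
proof (rule topological_basisI)
  show "open S" if "S \<in> small_cosets" for S
    using that open_coset compact_open_subgroupD(2)[OF inv_iterate_subgroup]
    by (auto simp: small_cosets_def)
next
  fix V and x :: 'a assume V: "open V" "x \<in> V"
  have "open ((+) (- x) ` V)" "0 \<in> (+) (- x) ` V"
    using V by (simp_all add: open_coset mem_coset_iff del: add_uminus_conv_diff uminus_add_conv_diff)
  then obtain n where n: "(inv A ^^ n) ` H \<subseteq> (+) (- x) ` V"
    using iterates_neighbourhood_base[OF inv_Aut(1)[OF A] H antimono_inv_iterates Inter_inv_iterates]
    by blast
  show "\<exists>S\<in>small_cosets. x \<in> S \<and> S \<subseteq> V"
  proof (intro bexI conjI)
    show "x \<in> (+) x ` (inv A ^^ n) ` H"
      using add_subgroupD(1)[OF compact_open_subgroupD(3)[OF inv_iterate_subgroup]]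
      by (simp add: mem_coset_iff)
    show "(+) x ` (inv A ^^ n) ` H \<subseteq> V"
    proof
      fix z assume "z \<in> (+) x ` (inv A ^^ n) ` H"
      then have "z - x \<in> (inv A ^^ n) ` H" by (simp only: mem_coset_iff)
      with n have "z - x \<in> (+) (- x) ` V" by (rule subsetD)
      then have "z - x - - x \<in> V" by (simp only: mem_coset_iff)
      then show "z \<in> V" by simp
    qed
    show "(+) x ` (inv A ^^ n) ` H \<in> small_cosets" by (auto simp: small_cosets_def)
  qed
qed

text \<open>The subgroups \<open>A\<^sup>-\<^sup>n H\<close> form a chain, so of two cosets that meet one contains the other.\<close>

lemma Int_stable_small_cosets: "Int_stable small_cosets"
proof -
  have nested: "(+) x ` (inv A ^^ n) ` H \<inter> (+) y ` (inv A ^^ k) ` H \<in> small_cosets"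
    if "n \<le> k" for x y n k
  proof (cases "(+) x ` (inv A ^^ n) ` H \<inter> (+) y ` (inv A ^^ k) ` H = {}")
    case False
    then obtain z where z: "z \<in> (+) x ` (inv A ^^ n) ` H" "z \<in> (+) y ` (inv A ^^ k) ` H" by blast
    note eq = coset_eq[OF compact_open_subgroupD(3)[OF inv_iterate_subgroup]]
    have "(+) x ` (inv A ^^ n) ` H \<inter> (+) y ` (inv A ^^ k) ` H = (+) z ` (inv A ^^ k) ` H"
      unfolding eq[OF z(1)] eq[OF z(2)] using antimonoD[OF antimono_inv_iterates that] by auto
    then show ?thesis by (auto simp: small_cosets_def)
  qed (simp add: small_cosets_def)
  show ?thesis
  proof (rule Int_stableI)
    fix S S' assume "S \<in> small_cosets" "S' \<in> small_cosets"
    then consider "S = {} \<or> S' = {}"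
      | x n y k where "S = (+) x ` (inv A ^^ n) ` H" "S' = (+) y ` (inv A ^^ k) ` H"
      unfolding small_cosets_def by auto
    then show "S \<inter> S' \<in> small_cosets"
    proof cases
      case 2
      show ?thesis
      proof (cases "n \<le> k")
        case True
        then show ?thesis using nested 2 by simp
      next
        case False
        then show ?thesis using nested[of k n y x] 2 by (simp add: Int_commute)
      qed
    qed (auto simp: small_cosets_def)
  qed
qed

text \<open>The factor is the index \<open>q\<close> of \<open>H\<close> in \<open>A H\<close>. Since \<open>A\<^sup>-\<^sup>n\<close> carries the pair \<open>H \<subseteq> A H\<close> to
  \<open>A\<^sup>-\<^sup>n H \<subseteq> A A\<^sup>-\<^sup>n H\<close>, the index is the same at every level, so \<open>m(A S) = q m(S)\<close> for every coset \<open>S\<close> of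
  \<open>A\<^sup>-\<^sup>n H\<close>. These cosets generate the Borel sets and countably many of them, each of finite measure,
  cover the group; two measures that agree on them are equal.\<close>

lemma modulus_exists:
  obtains q :: nat where "q > 0"
    "\<And>U. U \<in> sets borel \<Longrightarrow> emeasure m (A ` U) = ennreal (real q) * emeasure m U"
proof -
  have sets: "sets m = sets borel" and inv: "\<And>x U. U \<in> sets borel \<Longrightarrow> emeasure m ((+) x ` U) = emeasure m U"
    and fin: "\<And>K. compact K \<Longrightarrow> emeasure m K < \<infinity>"
    using m by (auto simp: haar_measure_def)
  have space: "space m = UNIV" using sets_eq_imp_space_eq[OF sets] by simp
  obtain T where T: "transversal T H (A ` H)"
    using transversal_exists compact_open_subgroupD H compact_open_subgroup_image[OF A H] subset_image
    by metis
  define q where "q = card T"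
  have "T \<noteq> {}" using T add_subgroupD(1)[OF compact_open_subgroupD(3)[OF H]] by (auto simp: transversal_def)
  then have q: "q > 0" using T by (auto simp: q_def transversal_def card_gt_0_iff)
  have meas: "inv A \<in> measurable m borel"
    using borel_measurable_continuous_onI[OF AutD(6)[OF inv_Aut(1)[OF A]]]
    by (simp add: measurable_cong_sets[OF sets])
  have vim: "inv A -` U = A ` U" for U by (rule Aut_image_eq_vimage[OF A, symmetric])
  \<comment> \<open>The measure \<open>U \<mapsto> m(A U)\<close> is the image of \<open>m\<close> under the inverse of \<open>A\<close>.\<close>
  have distr: "emeasure (distr m borel (inv A)) U = emeasure m (A ` U)" if "U \<in> sets borel" for U
    using that by (simp add: emeasure_distr[OF meas] space vim)
  have gen: "sets borel = sigma_sets UNIV small_cosets"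
    by (simp add: borel_eq_countable_basis[OF countable_small_cosets topological_basis_small_cosets])
  have bor: "S \<in> sets borel" if "S \<in> small_cosets" for S
    using topological_basis_open[OF topological_basis_small_cosets that] by (rule borel_open)
  have agree: "emeasure m (A ` S) = ennreal (real q) * emeasure m S" if S: "S \<in> small_cosets" for S
  proof (cases "S = {}")
    case False
    with S obtain x n where Sx: "S = (+) x ` (inv A ^^ n) ` H" unfolding small_cosets_def by auto
    let ?K = "(inv A ^^ n) ` H"
    have K: "open ?K" by (rule compact_open_subgroupD(2)[OF inv_iterate_subgroup])
    have "(inv A ^^ n) ` A ` H = A ` ?K" by (simp add: image_image funpow_inv_commute[OF A])
    then have "transversal ((inv A ^^ n) ` T) ?K (A ` ?K)"
      using transversal_image(1)[OF funpow_Aut[OF inv_Aut(1)[OF A]] T, of n] by simp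
    then have "emeasure m (A ` ?K) = of_nat q * emeasure m ?K"
      using emeasure_transversal[OF m _ K] transversal_image(2)[OF funpow_Aut[OF inv_Aut(1)[OF A]] T]
      by (simp add: q_def)
    then show ?thesis
      using K open_Aut_image[OF A K] by (simp add: Sx image_coset[OF A] inv ennreal_of_nat_eq_real_of_nat)
  qed simp
  have "distr m borel (inv A) = scale_measure (ennreal (real q)) m"
  proof (rule measure_eqI_generator_eq_countable[OF Int_stable_small_cosets, where \<Omega> = UNIV and A = small_cosets])
    show "emeasure (distr m borel (inv A)) S = emeasure (scale_measure (ennreal (real q)) m) S"
      if "S \<in> small_cosets" for S
      using that by (simp add: distr bor agree)
    show "\<Union>small_cosets = UNIV"
      using topological_basisE[OF topological_basis_small_cosets open_UNIV UNIV_I] by blast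
    show "emeasure (distr m borel (inv A)) S \<noteq> \<infinity>" if "S \<in> small_cosets" for S
    proof -
      have "compact ((+) x ` (inv A ^^ n) ` H)" for x n
        by (rule compact_continuous_image[OF _ compact_open_subgroupD(1)[OF inv_iterate_subgroup]])
          (intro continuous_intros)
      then have "compact S" using that by (auto simp: small_cosets_def)
      then have "compact (A ` S)" using AutD(6)[OF A] by (intro compact_continuous_image)
      then show ?thesis using fin that by (auto simp: distr bor dest!: fin)
    qed
  qed (auto simp: gen sets countable_small_cosets)
  then have "emeasure m (A ` U) = ennreal (real q) * emeasure m U" if "U \<in> sets borel" for U
    using distr[OF that] by simp
  with q that show ?thesis by blast
qed

lemma modulus:
  shows modulus_pos: "modulus m A > 0"
    and emeasure_image: "U \<in> sets borel \<Longrightarrow> emeasure m (A ` U) = ennreal (modulus m A) * emeasure m U"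
proof -
  obtain q :: nat where q: "q > 0"
    "\<And>U. U \<in> sets borel \<Longrightarrow> emeasure m (A ` U) = ennreal (real q) * emeasure m U"
    using modulus_exists by blast
  have HB: "H \<in> sets borel" using compact_open_subgroupD(2)[OF H] by simp
  have "modulus m A = real q"
    unfolding modulus_def
  proof (rule the_equality)
    fix c :: real assume c: "c > 0 \<and> (\<forall>U\<in>sets borel. emeasure m (A ` U) = ennreal c * emeasure m U)"
    then have "ennreal c = ennreal (real q)" using q(2)[OF HB] HB mH by (metis mult.right_neutral)
    then show "c = real q" using c by (subst (asm) ennreal_inj) auto
  qed (use q in auto)
  then show "modulus m A > 0" "U \<in> sets borel \<Longrightarrow> emeasure m (A ` U) = ennreal (modulus m A) * emeasure m U"
    using q by auto
qed

lemma emeasure_iterate: "emeasure m ((A ^^ n) ` H) = ennreal (modulus m A ^ n)"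
proof (induction n)
  case (Suc n)
  have "(A ^^ Suc n) ` H = A ` (A ^^ n) ` H" by (simp add: image_comp)
  moreover have "(A ^^ n) ` H \<in> sets borel" using compact_open_subgroupD(2)[OF iterate_subgroup] by simp
  ultimately show ?case
    using modulus_pos by (simp add: emeasure_image Suc ennreal_mult'')
qed (simp add: mH)

end

section \<open>Comparison of the densities\<close>

text \<open>Each translate of \<open>A\<^sup>n H\<close> splits into \<open>N\<close> translates of \<open>B\<^sup>k H\<close>, so the supremum of the counts grows
  at most by the factor \<open>N\<close>, and the infimum at least by it. By comparison of measures
  \<open>|A|\<^sup>n = N |B|\<^sup>k\<close>, so the normalisation cancels \<open>N\<close>.\<close>

lemma density_comparison:
  fixes H :: "'a::{topological_ab_group_add, t2_space} set" and m :: "'a measure"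
  assumes eA: "expanding_automorphism H m A" and eB: "expanding_automorphism H m B"
    and sub: "(B ^^ k) ` H \<subseteq> (A ^^ n) ` H"
  shows "ennreal (1 / modulus m A ^ n) * (SUP x. num_points I lam ((+) x ` (A ^^ n) ` H))
          \<le> ennreal (1 / modulus m B ^ k) * (SUP x. num_points I lam ((+) x ` (B ^^ k) ` H))" (is ?S)
    and "ennreal (1 / modulus m B ^ k) * (INF x. num_points I lam ((+) x ` (B ^^ k) ` H))
          \<le> ennreal (1 / modulus m A ^ n) * (INF x. num_points I lam ((+) x ` (A ^^ n) ` H))" (is ?I)
proof -
  interpret A: expanding_automorphism H m A by fact
  interpret B: expanding_automorphism H m B by fact
  obtain T where T: "transversal T ((B ^^ k) ` H) ((A ^^ n) ` H)"
    using transversal_exists compact_open_subgroupD A.iterate_subgroup B.iterate_subgroup sub by metis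
  let ?a = "modulus m A ^ n" and ?b = "modulus m B ^ k" and ?N = "real (card T)"
  have pos: "?a > 0" "?b > 0" using A.modulus_pos B.modulus_pos by auto
  have "ennreal ?a = ennreal (?N * ?b)"
    using emeasure_transversal[OF A.m T] compact_open_subgroupD(2)[OF B.iterate_subgroup]
      A.emeasure_iterate B.emeasure_iterate pos
    by (simp add: ennreal_mult ennreal_of_nat_eq_real_of_nat)
  then have ab: "?a = ?N * ?b" using pos by (subst (asm) ennreal_inj) auto
  have "ennreal (1 / ?a) * of_nat (card T) = ennreal (1 / ?a * ?N)"
    using pos by (subst ennreal_mult) (auto simp: ennreal_of_nat_eq_real_of_nat)
  also have "1 / ?a * ?N = 1 / ?b"
  proof -
    have "?N \<noteq> 0" using pos(1) ab by (metis less_irrefl mult_zero_left)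
    then show ?thesis by (simp add: ab)
  qed
  finally have scale: "ennreal (1 / ?a) * (of_nat (card T) * c) = ennreal (1 / ?b) * c" for c
    by (simp add: mult.assoc[symmetric])
  have split: "num_points I lam ((+) x ` (A ^^ n) ` H)
      = (\<Sum>t\<in>T. num_points I lam ((+) (x + t) ` (B ^^ k) ` H))" for x
    by (rule num_points_transversal[OF T])
  let ?f = "\<lambda>x. num_points I lam ((+) x ` (B ^^ k) ` H)"
  have "(SUP x. num_points I lam ((+) x ` (A ^^ n) ` H)) \<le> of_nat (card T) * (SUP x. ?f x)"
    unfolding split by (intro SUP_least sum_bounded_above SUP_upper UNIV_I)
  from mult_left_mono[OF this, of "ennreal (1 / ?a)"] show ?S by (simp add: scale)
  have "of_nat (card T) * (INF x. ?f x) \<le> (INF x. num_points I lam ((+) x ` (A ^^ n) ` H))"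
    unfolding split by (intro INF_greatest sum_bounded_below INF_lower UNIV_I)
  from mult_left_mono[OF this, of "ennreal (1 / ?a)"] show ?I by (simp add: scale)
qed

text \<open>The hypothesis bounds the upper limit of \<open>f\<close> by every value of \<open>g\<close> at a nonnegative integer, hence by
  the lower limit of \<open>g\<close>.\<close>

lemma Limsup_le_Limsup_of_eventually:
  fixes f g :: "int \<Rightarrow> ennreal"
  assumes "\<And>k. k \<ge> 0 \<Longrightarrow> eventually (\<lambda>n. f n \<le> g k) at_top"
  shows "Limsup at_top f \<le> Limsup at_top g"
proof -
  have "Limsup at_top f \<le> g k" if "k \<ge> 0" for k
    by (rule Limsup_bounded[OF assms[OF that]])
  then have "Limsup at_top f \<le> Liminf at_top g"
    by (intro Liminf_bounded eventually_at_top_linorderI[of 0])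
  also have "\<dots> \<le> Limsup at_top g" by (rule Liminf_le_Limsup) simp
  finally show ?thesis .
qed

lemma Liminf_le_Liminf_of_eventually:
  fixes f g :: "int \<Rightarrow> ennreal"
  assumes "\<And>k. k \<ge> 0 \<Longrightarrow> eventually (\<lambda>n. g k \<le> f n) at_top"
  shows "Liminf at_top g \<le> Liminf at_top f"
proof -
  have "g k \<le> Liminf at_top f" if "k \<ge> 0" for k
    by (rule Liminf_bounded[OF assms[OF that]])
  then have "Limsup at_top g \<le> Liminf at_top f"
    by (intro Limsup_bounded eventually_at_top_linorderI[of 0])
  moreover have "Liminf at_top g \<le> Limsup at_top g" by (rule Liminf_le_Limsup) simp
  ultimately show ?thesis by simp
qed

lemma density_le:
  fixes H :: "'a::{topological_ab_group_add, t2_space} set" and m :: "'a measure"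
  assumes eA: "expanding_automorphism H m A" and eB: "expanding_automorphism H m B"
  shows "upper_density m H A I lam \<le> upper_density m H B I lam"
    and "lower_density m H B I lam \<le> lower_density m H A I lam"
proof -
  interpret A: expanding_automorphism H m A by fact
  interpret B: expanding_automorphism H m B by fact
  have ev: "eventually (\<lambda>n. n \<ge> 0 \<and> (B ^^ nat k) ` H \<subseteq> (A ^^ nat n) ` H) at_top" for k :: int
  proof -
    obtain n0 where n0: "(B ^^ nat k) ` H \<subseteq> (A ^^ n0) ` H"
      using compact_subset_increasing_union[of "(B ^^ nat k) ` H" "\<lambda>n. (A ^^ n) ` H"]
        compact_open_subgroupD[OF A.iterate_subgroup] compact_open_subgroupD[OF B.iterate_subgroup]
        A.mono_iterates A.Union_iterates by auto
    show ?thesis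
    proof (rule eventually_at_top_linorderI[of "int n0"])
      fix n assume "int n0 \<le> n"
      then have "n0 \<le> nat n" "n \<ge> 0" by auto
      then show "n \<ge> 0 \<and> (B ^^ nat k) ` H \<subseteq> (A ^^ nat n) ` H"
        using n0 monoD[OF A.mono_iterates, of n0 "nat n"] by auto
    qed
  qed
  have Q: "Q C H n x = (+) x ` (C ^^ nat n) ` H" "c powi n = c ^ nat n" if "n \<ge> 0"
    for C n x and c :: real
    using that by (simp_all add: Q_def aut_pow_def power_int_def)
  show "upper_density m H A I lam \<le> upper_density m H B I lam"
    unfolding upper_density_def
  proof (rule Limsup_le_Limsup_of_eventually)
    fix k :: int assume k: "k \<ge> 0"
    show "eventually (\<lambda>n. ennreal (1 / modulus m A powi n) * (SUP x. num_points I lam (Q A H n x))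
       \<le> ennreal (1 / modulus m B powi k) * (SUP x. num_points I lam (Q B H k x))) at_top"
      using ev[of k] by eventually_elim (use k density_comparison(1)[OF eA eB, where I = I and lam = lam] in \<open>simp add: Q\<close>)
  qed
  show "lower_density m H B I lam \<le> lower_density m H A I lam"
    unfolding lower_density_def
  proof (rule Liminf_le_Liminf_of_eventually)
    fix k :: int assume k: "k \<ge> 0"
    show "eventually (\<lambda>n. ennreal (1 / modulus m B powi k) * (INF x. num_points I lam (Q B H k x))
       \<le> ennreal (1 / modulus m A powi n) * (INF x. num_points I lam (Q A H n x))) at_top"
      using ev[of k] by eventually_elim (use k density_comparison(2)[OF eA eB, where I = I and lam = lam] in \<open>simp add: Q\<close>)
  qed
qed

theorem lemma3p0p4:
  fixes H :: "'a::{topological_ab_group_add, t2_space} set"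
    and A B :: "'a \<Rightarrow> 'a"
    and m :: "'a measure"
    and I :: "'i set" and lam :: "'i \<Rightarrow> 'a"
  assumes "locally_compact_space (euclidean :: 'a topology)"
    and "compact_open_subgroup H"
    and "haar_measure m" and "emeasure m H = 1"
    and "A \<in> Aut" and "B \<in> Aut"
    and "expansive A H" and "expansive B H"
    and "expansive (dual_aut A) (annihilator H)" and "expansive (dual_aut B) (annihilator H)"
  shows "upper_density m H A I lam = upper_density m H B I lam \<and>
         lower_density m H A I lam = lower_density m H B I lam"
proof -
  have "expanding_automorphism H m A" "expanding_automorphism H m B"
    using assms by (auto intro: expanding_automorphism.intro)
  then show ?thesis by (intro conjI antisym density_le)
qed

end
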